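(* Let $k$ be an algebraically closed field of characteristic zero, $B=k[x,y]$, and let $D$ be a nice locally nilpotent $k$-derivation of $B$ (i.e. $D^2(x)=D^2(y)=0$) with slice $s$ (i.e. $D(s)=1$). Let $N\in\mathbb{Z}\setminus\{0\}$. Then the $\mathbb{G}_{\mathrm m}$-action on $\mathbb{A}^2=\operatorname{Spec}(B)$ associated with $\partial=NsD$ is linearizable, and $D$ is conjugate to $\frac{\partial}{\partial y}$, i.e. there is $\phi\in\operatorname{Aut}_k(B)$ with $\phi D\phi^{-1}=\frac{\partial}{\partial y}$.
   Context: A $k$-derivation $D$ of $B$ is locally nilpotent if for every $b\in B$ there is $m\ge1$ with $D^m(b)=0$. With $A=\ker D$, $B=A[s]$ is a polynomial ring in $s$ over $A$, and the action associated with $\partial=NsD$ is $\alpha_t(P(s))=P(t^Ns)$ for $P\in A[T]$, $t\in k^*$. It is called linearizable if there exists $\phi\in\operatorname{Aut}_k(B)$ such that $\phi\partial\phi^{-1}$ is a diagonal linear derivation $\lambda_1x\frac{\partial}{\partial x}+\lambda_2y\frac{\partial}{\partial y}$, $\lambda_i\in k$. *)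

theory Defs
  imports "HOL-Computational_Algebra.Computational_Algebra"
begin

text \<open>
  The polynomial ring $k[x,y]$ is represented as $k[x][y]$, i.e. by the type \<open>'k poly poly\<close>:
  the outer polynomial variable is $y$, the inner one is $x$.
\<close>

definition const2 :: "'k::field \<Rightarrow> 'k poly poly" where
  "const2 c = [:[:c:]:]"

definition varX :: "'k::field poly poly" where
  "varX = [:[:0, 1:]:]"

definition varY :: "'k::field poly poly" where
  "varY = [:0, 1:]"

text \<open>
  The partial derivative in $y$ differentiates the outer polynomial, the one in $x$
  differentiates each coefficient.
\<close>

definition partial_y :: "'k::field poly poly \<Rightarrow> 'k poly poly" where
  "partial_y f = pderiv f"

definition partial_x :: "'k::field poly poly \<Rightarrow> 'k poly poly" where
  "partial_x f = map_poly pderiv f"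

definition k_derivation :: "('k::field poly poly \<Rightarrow> 'k poly poly) \<Rightarrow> bool" where
  "k_derivation D \<longleftrightarrow>
     (\<forall>f g. D (f + g) = D f + D g) \<and>
     (\<forall>c f. D (const2 c * f) = const2 c * D f) \<and>
     (\<forall>f g. D (f * g) = f * D g + D f * g)"

definition locally_nilpotent :: "('k::field poly poly \<Rightarrow> 'k poly poly) \<Rightarrow> bool" where
  "locally_nilpotent D \<longleftrightarrow> (\<forall>b. \<exists>m\<ge>1. (D ^^ m) b = 0)"

definition nice_LND :: "('k::field poly poly \<Rightarrow> 'k poly poly) \<Rightarrow> bool" where
  "nice_LND D \<longleftrightarrow>
     k_derivation D \<and> locally_nilpotent D \<and>
     (D ^^ 2) varX = 0 \<and> (D ^^ 2) varY = 0"

definition is_slice :: "('k::field poly poly \<Rightarrow> 'k poly poly) \<Rightarrow> 'k poly poly \<Rightarrow> bool" where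
  "is_slice D s \<longleftrightarrow> D s = 1"

definition k_automorphism :: "('k::field poly poly \<Rightarrow> 'k poly poly) \<Rightarrow> bool" where
  "k_automorphism \<phi> \<longleftrightarrow>
     bij \<phi> \<and>
     (\<forall>f g. \<phi> (f + g) = \<phi> f + \<phi> g) \<and>
     (\<forall>f g. \<phi> (f * g) = \<phi> f * \<phi> g) \<and>
     (\<forall>c. \<phi> (const2 c) = const2 c)"

text \<open>
  The action \<open>\<alpha>\<^sub>t(P(s)) = P(t\<^sup>N s)\<close> for polynomials \<open>P\<close> over \<open>A = ker D\<close>.
  The description operator is justified because $B = A[s]$ is a polynomial ring in $s$ over $A$
  whenever \<open>D\<close> is locally nilpotent with slice \<open>s\<close>; only \<open>t \<noteq> 0\<close> is meaningful.
\<close>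

definition slice_action ::
  "('k::field poly poly \<Rightarrow> 'k poly poly) \<Rightarrow> 'k poly poly \<Rightarrow> int \<Rightarrow> 'k \<Rightarrow> 'k poly poly \<Rightarrow> 'k poly poly"
  where
  "slice_action D s N t b =
     (THE c. \<exists>P :: 'k poly poly poly.
        (\<forall>i. D (coeff P i) = 0) \<and> b = poly P s \<and> c = poly P (const2 (t powi N) * s))"

text \<open>
  A $\mathbb{G}_m$-action on $\operatorname{Spec} B$, given by its action on \<open>B\<close>: every \<open>b\<close> has
  a finite expansion \<open>\<alpha>\<^sub>t(b) = \<Sum>\<^sub>n t\<^sup>n b\<^sub>n\<close>, \<open>n\<close> ranging over the integers.
  Its derivation, the derivative at \<open>t = 1\<close>, is \<open>\<delta>(b) = \<Sum>\<^sub>n n b\<^sub>n\<close>.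
\<close>

definition Gm_action_of_derivation ::
  "('k::field \<Rightarrow> 'k poly poly \<Rightarrow> 'k poly poly) \<Rightarrow> ('k poly poly \<Rightarrow> 'k poly poly) \<Rightarrow> bool"
  where
  "Gm_action_of_derivation \<alpha> \<delta> \<longleftrightarrow>
     (\<forall>t. t \<noteq> 0 \<longrightarrow> k_automorphism (\<alpha> t)) \<and>
     (\<forall>b. \<alpha> 1 b = b) \<and>
     (\<forall>t u b. t \<noteq> 0 \<longrightarrow> u \<noteq> 0 \<longrightarrow> \<alpha> (t * u) b = \<alpha> t (\<alpha> u b)) \<and>
     (\<forall>b. \<exists>c :: int \<Rightarrow> 'k poly poly. finite {n. c n \<noteq> 0} \<and>
        (\<forall>t. t \<noteq> 0 \<longrightarrow> \<alpha> t b = (\<Sum>n | c n \<noteq> 0. const2 (t powi n) * c n)) \<and>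
        \<delta> b = (\<Sum>n | c n \<noteq> 0. of_int n * c n))"

definition conj_by ::
  "('k::field poly poly \<Rightarrow> 'k poly poly) \<Rightarrow> ('k poly poly \<Rightarrow> 'k poly poly) \<Rightarrow> 'k poly poly \<Rightarrow> 'k poly poly"
  where
  "conj_by \<phi> D = \<phi> \<circ> D \<circ> inv \<phi>"

definition diagonal_derivation :: "'k::field \<Rightarrow> 'k \<Rightarrow> 'k poly poly \<Rightarrow> 'k poly poly" where
  "diagonal_derivation l1 l2 f =
     const2 l1 * varX * partial_x f + const2 l2 * varY * partial_y f"

text \<open>
  Linearizability of an action is a condition on its derivation, so the action is carried along
  with its derivation \<open>\<delta>\<close>.
\<close>

definition linearizable_action ::
  "('k::field \<Rightarrow> 'k poly poly \<Rightarrow> 'k poly poly) \<Rightarrow> ('k poly poly \<Rightarrow> 'k poly poly) \<Rightarrow> bool"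
  where
  "linearizable_action \<alpha> \<delta> \<longleftrightarrow>
     Gm_action_of_derivation \<alpha> \<delta> \<and>
     (\<exists>\<phi> l1 l2. k_automorphism \<phi> \<and> conj_by \<phi> \<delta> = diagonal_derivation l1 l2)"

end

theory Submission
  imports Defs
begin

text \<open>
  Write \<open>a = D x\<close> and \<open>b = D y\<close>. That \<open>D\<close> is nice means \<open>D a = D b = 0\<close>, that is
  \<open>a a\<^sub>x + b a\<^sub>y = 0\<close> and \<open>a b\<^sub>x + b b\<^sub>y = 0\<close>, while the slice gives \<open>a s\<^sub>x + b s\<^sub>y = 1\<close>, so that
  \<open>a\<close> and \<open>b\<close> generate the unit ideal. Hence \<open>a\<close> divides its own \<open>y\<close>-derivative, which for degree
  reasons forces \<open>a\<^sub>y = 0\<close>, and then \<open>a\<^sub>x = 0\<close>; in the same way \<open>b\<close> is constant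
  (\<open>nice_derivation_with_slice_constant\<close>). A derivation with constant coefficients
  is turned into \<open>\<partial>/\<partial>y\<close> by a linear change of coordinates. In the new coordinates the
  slice has \<open>y\<close>-derivative \<open>1\<close>, so it is \<open>y + p(x)\<close>, and a triangular automorphism, which
  does not disturb \<open>\<partial>/\<partial>y\<close>, moves it to \<open>y\<close>. Thus there are coordinates in which
  \<open>D = \<partial>/\<partial>y\<close> and \<open>s = y\<close> simultaneously (\<open>straightening_automorphism\<close>).

  Both claims can be read off from these coordinates: \<open>NsD\<close> becomes \<open>N y \<partial>/\<partial>y\<close>, which is diagonal,
  and the action becomes the scaling \<open>y \<mapsto> t\<^sup>N y\<close> (\<open>slice_action_straightened\<close>), whose weight
  space of weight \<open>N i\<close> is spanned over \<open>k[x]\<close> by \<open>y\<^sup>i\<close>; the derivative at \<open>t = 1\<close> multiplies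
  \<open>y\<^sup>i\<close> by \<open>N i\<close>, as does \<open>N y \<partial>/\<partial>y\<close>.
\<close>

section \<open>Endomorphisms and derivations of the polynomial ring in two variables\<close>

lemma const2_simps [simp]:
  "const2 0 = 0" "const2 1 = 1"
  "const2 (a + b) = const2 a + const2 b" "const2 (a * b) = const2 a * const2 b"
  "const2 (- a) = - const2 a" "const2 a = 0 \<longleftrightarrow> a = 0"
  by (simp_all add: const2_def one_pCons)

lemma const2_of_nat [simp]: "const2 (of_nat n) = of_nat n"
  by (induction n) simp_all

lemma const2_of_int [simp]: "const2 (of_int n) = of_int n"
  by (cases n) (simp_all flip: of_nat_Suc)

lemma bivariate_induct [case_names const varX varY add mult]:
  fixes f :: "'k::field poly poly"
  assumes const: "\<And>c. P (const2 c)" and X: "P varX" and Y: "P varY"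
    and add: "\<And>f g. P f \<Longrightarrow> P g \<Longrightarrow> P (f + g)"
    and mult: "\<And>f g. P f \<Longrightarrow> P g \<Longrightarrow> P (f * g)"
  shows "P f"
proof -
  have inner: "P [:p:]" for p :: "'k poly"
  proof (induction p)
    case 0
    show ?case using const[of 0] by simp
  next
    case (pCons c p)
    have "[:pCons c p:] = const2 c + varX * [:p:]"
      by (simp add: const2_def varX_def)
    then show ?case using pCons add const mult X by metis
  qed
  show ?thesis
  proof (induction f)
    case 0
    show ?case using const[of 0] by simp
  next
    case (pCons p f)
    have "pCons p f = [:p:] + varY * f"
      by (simp add: varY_def)
    then show ?case using pCons add inner mult Y by metis
  qed
qed

definition k_endomorphism :: "('k::field poly poly \<Rightarrow> 'k poly poly) \<Rightarrow> bool" where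
  "k_endomorphism h \<longleftrightarrow>
     (\<forall>f g. h (f + g) = h f + h g) \<and> (\<forall>f g. h (f * g) = h f * h g) \<and>
     (\<forall>c. h (const2 c) = const2 c)"

lemma k_automorphism_iff: "k_automorphism h \<longleftrightarrow> bij h \<and> k_endomorphism h"
  by (auto simp: k_automorphism_def k_endomorphism_def)

lemma k_endomorphismD:
  assumes "k_endomorphism h"
  shows "h (f + g) = h f + h g" "h (f * g) = h f * h g" "h (const2 c) = const2 c"
    "h 0 = 0" "h 1 = 1" "h (- f) = - h f" "h (f - g) = h f - h g" "h (of_int n) = of_int n"
proof -
  show add: "h (f + g) = h f + h g" and "h (f * g) = h f * h g"
    and c: "\<And>c. h (const2 c) = const2 c" for f g
    using assms by (auto simp: k_endomorphism_def)
  show "h 0 = 0" "h 1 = 1" "h (of_int n) = of_int n"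
    using c[of 0] c[of 1] c[of "of_int n"] by simp_all
  then show m: "h (- f) = - h f" for f
    using add[of f "- f"] by (simp add: add_eq_0_iff)
  show "h (f - g) = h f - h g"
    using add[of f "- g"] m by simp
qed

lemma k_endomorphism_sum:
  assumes "k_endomorphism h"
  shows "h (\<Sum>i\<in>I. F i) = (\<Sum>i\<in>I. h (F i))"
  by (induction I rule: infinite_finite_induct) (simp_all add: k_endomorphismD[OF assms])

lemma k_endomorphism_comp:
  assumes "k_endomorphism g" "k_endomorphism h"
  shows "k_endomorphism (g \<circ> h)"
  using assms by (simp add: k_endomorphism_def)

lemma k_endomorphism_id: "k_endomorphism (\<lambda>f. f)"
  by (simp add: k_endomorphism_def)

lemma k_endomorphism_eqI:
  assumes "k_endomorphism g" "k_endomorphism h" "g varX = h varX" "g varY = h varY"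
  shows "g f = h f"
  using assms by (induction f rule: bivariate_induct) (simp_all add: k_endomorphismD)

lemma k_automorphism_of_inverse_on_variables:
  assumes g: "k_endomorphism g" and h: "k_endomorphism h"
    and "h (g varX) = varX" "h (g varY) = varY" "g (h varX) = varX" "g (h varY) = varY"
  shows "k_automorphism g" "h (g f) = f" "g (h f) = f"
proof -
  show hg: "h (g f) = f" and gh: "g (h f) = f" for f
    using k_endomorphism_eqI[OF k_endomorphism_comp[OF h g] k_endomorphism_id, of f]
      k_endomorphism_eqI[OF k_endomorphism_comp[OF g h] k_endomorphism_id, of f] assms
    by simp_all
  then show "k_automorphism g"
    using g unfolding k_automorphism_iff by (metis bijI')
qed

lemma k_automorphism_comp:
  "k_automorphism g \<Longrightarrow> k_automorphism h \<Longrightarrow> k_automorphism (g \<circ> h)"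
  by (simp add: k_automorphism_iff bij_comp k_endomorphism_comp)

lemma k_automorphism_inv:
  assumes "k_automorphism g"
  shows "k_automorphism (inv g)"
proof -
  have b: "bij g" and h: "k_endomorphism g"
    using assms by (simp_all add: k_automorphism_iff)
  have g: "g (inv g f) = f" and i: "inv g (g f) = f" for f
    using b by (simp_all add: bij_is_surj surj_f_inv_f bij_is_inj)
  have "inv g (f1 + f2) = inv g f1 + inv g f2" "inv g (f1 * f2) = inv g f1 * inv g f2"
    "inv g (const2 c) = const2 c" for f1 f2 c
    using i[of "inv g f1 + inv g f2"] i[of "inv g f1 * inv g f2"] i[of "const2 c"]
    by (simp_all add: k_endomorphismD[OF h] g)
  then show ?thesis
    using b by (simp add: k_automorphism_def bij_imp_bij_inv)
qed

text \<open>
  Evaluation at \<open>q\<close> after a ring homomorphism of coefficients. It serves twice, to substitute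
  for the inner variable and for the outer one.
\<close>

definition eval_hom :: "('a::comm_ring_1 \<Rightarrow> 'b::comm_ring_1) \<Rightarrow> 'b \<Rightarrow> 'a poly \<Rightarrow> 'b" where
  "eval_hom h q f = poly (map_poly h f) q"

lemma eval_hom_0 [simp]: "eval_hom h q 0 = 0"
  by (simp add: eval_hom_def)

lemma eval_hom_pCons: "h 0 = 0 \<Longrightarrow> eval_hom h q (pCons c f) = h c + q * eval_hom h q f"
  by (simp add: eval_hom_def map_poly_pCons)

lemma eval_hom_ring_hom:
  assumes "h 0 = 0" and add: "\<And>a b. h (a + b) = h a + h b" and "\<And>a b. h (a * b) = h a * h b"
  shows "eval_hom h q (f + g) = eval_hom h q f + eval_hom h q g"
    and "eval_hom h q (f * g) = eval_hom h q f * eval_hom h q g"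
proof -
  note pCons = eval_hom_pCons[of h, OF assms(1)]
  show eadd: "eval_hom h q (f + g) = eval_hom h q f + eval_hom h q g" for f g
    by (induction f g rule: poly_induct2) (simp_all add: pCons assms algebra_simps)
  have smult: "eval_hom h q (smult c g) = h c * eval_hom h q g" for c
    by (induction g) (simp_all add: pCons assms algebra_simps)
  show "eval_hom h q (f * g) = eval_hom h q f * eval_hom h q g"
    by (induction f) (simp_all add: pCons assms eadd smult algebra_simps)
qed

definition subst2 :: "'k::field poly poly \<Rightarrow> 'k poly poly \<Rightarrow> 'k poly poly \<Rightarrow> 'k poly poly" where
  "subst2 p q = eval_hom (eval_hom const2 p) q"

lemma subst2_endomorphism [simp]: "k_endomorphism (subst2 p q)"
proof -
  note inner = eval_hom_ring_hom[of const2 p, simplified]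
  show ?thesis
    by (simp add: k_endomorphism_def subst2_def eval_hom_ring_hom inner)
      (simp add: const2_def[of c for c] eval_hom_pCons)
qed

lemma subst2_inner: "subst2 p q [:f:] = eval_hom const2 p f"
  by (simp add: subst2_def eval_hom_pCons)

lemma subst2_varX [simp]: "subst2 p q varX = p"
  by (simp add: subst2_inner varX_def eval_hom_pCons)

lemma subst2_varY [simp]: "subst2 p q varY = q"
  by (simp add: subst2_def varY_def eval_hom_pCons eval_hom_pCons[of const2])
    (simp add: one_pCons eval_hom_pCons)

lemma subst2_varX_inner [simp]: "subst2 varX q [:f:] = [:f:]"
proof -
  have "eval_hom const2 varX f = [:f:]"
    by (induction f) (simp_all add: eval_hom_pCons varX_def const2_def)
  then show ?thesis
    by (simp add: subst2_inner)
qed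

lemma k_derivationD:
  assumes "k_derivation D"
  shows "D (f + g) = D f + D g" "D (f * g) = f * D g + D f * g" "D (const2 c) = 0"
    "D (f - g) = D f - D g" "D (const2 c * f) = const2 c * D f"
proof -
  show add: "D (f + g) = D f + D g" and mult: "D (f * g) = f * D g + D f * g"
    and scal: "D (const2 c * f) = const2 c * D f" for f g c
    using assms by (auto simp: k_derivation_def)
  have "D 1 = D 1 + D 1"
    using mult[of 1 1] by (simp only: mult_1 mult_1_right)
  then have "D 1 = 0"
    by (metis add_cancel_right_right)
  then show "D (const2 c) = 0"
    using scal[of c 1] by simp
  show "D (f - g) = D f - D g"
    using add[of "f - g" g] by simp
qed

lemma k_derivation_intertwine:
  assumes "k_derivation D" "k_derivation E" "k_endomorphism h"
    and "h (D varX) = E (h varX)" "h (D varY) = E (h varY)"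
  shows "h (D f) = E (h f)"
  using assms
  by (induction f rule: bivariate_induct) (simp_all add: k_derivationD k_endomorphismD)

lemma partial_y_derivation: "k_derivation partial_y"
  by (simp add: k_derivation_def partial_y_def pderiv_add pderiv_mult const2_def pderiv_smult
      algebra_simps)

lemma partial_y_vars [simp]: "partial_y varX = 0" "partial_y varY = 1"
  by (simp_all add: partial_y_def varX_def varY_def pderiv_pCons)

lemma partial_x_pCons: "partial_x (pCons c f) = pCons (pderiv c) (partial_x f)"
  by (simp add: partial_x_def map_poly_pCons)

lemma partial_x_derivation: "k_derivation (partial_x :: 'k::field poly poly \<Rightarrow> _)"
proof -
  have add: "partial_x (f + g) = partial_x f + partial_x g" for f g :: "'k poly poly"
    by (rule poly_eqI) (simp add: partial_x_def coeff_map_poly pderiv_add)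
  have smult: "partial_x (smult c f) = smult c (partial_x f) + smult (pderiv c) f"
    for c and f :: "'k poly poly"
    by (rule poly_eqI) (simp add: partial_x_def coeff_map_poly pderiv_mult)
  have mult: "partial_x (f * g) = f * partial_x g + partial_x f * g" for f g :: "'k poly poly"
  proof (induction f)
    case 0
    show ?case by (simp add: partial_x_def)
  next
    case (pCons c f)
    then show ?case
      by (simp add: add smult partial_x_pCons algebra_simps)
  qed
  show ?thesis
    by (simp add: k_derivation_def add mult)
      (simp add: const2_def smult partial_x_pCons, simp add: partial_x_def)
qed

lemma partial_x_vars [simp]: "partial_x varX = 1" "partial_x varY = 0"
  by (simp_all add: varX_def varY_def partial_x_pCons pderiv_pCons one_pCons)
    (simp_all add: partial_x_def)

lemma k_derivation_chain_rule:
  assumes "k_derivation D"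
  shows "D f = D varX * partial_x f + D varY * partial_y f"
  by (induction f rule: bivariate_induct)
    (simp_all add: k_derivationD[OF assms] k_derivationD[OF partial_x_derivation]
      k_derivationD[OF partial_y_derivation] algebra_simps)

section \<open>Straightening a nice derivation with a slice\<close>

lemma dvd_partial_y_imp_zero:
  fixes f :: "'k::field_char_0 poly poly"
  assumes "f dvd partial_y f"
  shows "partial_y f = 0"
  using assms by (simp add: partial_y_def pderiv_eq_0_iff)

text \<open>
  Since \<open>\<partial>/\<partial>x\<close> does not raise the \<open>y\<close>-degree, a nonzero quotient has \<open>y\<close>-degree zero, and the
  leading coefficient of \<open>f\<close> divides its own derivative.
\<close>

lemma dvd_partial_x_imp_zero:
  fixes f :: "'k::field_char_0 poly poly"
  assumes "f dvd partial_x f"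
  shows "partial_x f = 0"
proof (rule ccontr)
  assume nz: "partial_x f \<noteq> 0"
  obtain q where q: "partial_x f = f * q"
    using assms by (auto simp: dvd_def)
  have "degree (f * q) \<le> degree f"
    unfolding q[symmetric] by (intro degree_le) (simp add: partial_x_def coeff_map_poly coeff_eq_0)
  moreover have "f \<noteq> 0" "q \<noteq> 0"
    using nz q by auto
  ultimately have "degree q = 0"
    by (simp add: degree_mult_eq)
  then obtain r where r: "q = [:r:]"
    by (metis degree_eq_zeroE)
  have "pderiv (lead_coeff f) = coeff (f * q) (degree f)"
    unfolding q[symmetric] by (simp add: partial_x_def coeff_map_poly)
  then have lc: "pderiv (lead_coeff f) = lead_coeff f * r"
    using r by (simp add: mult.commute)
  then have "lead_coeff f dvd pderiv (lead_coeff f)"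
    by simp
  then have "pderiv (lead_coeff f) = 0"
    by (simp add: pderiv_eq_0_iff)
  then show False
    using lc \<open>f \<noteq> 0\<close> \<open>q \<noteq> 0\<close> r by simp
qed

lemma constant_of_partials_zero:
  fixes f :: "'k::field_char_0 poly poly"
  assumes "partial_x f = 0" "partial_y f = 0"
  obtains c where "f = const2 c"
proof -
  obtain p where p: "f = [:p:]"
    using assms(2) by (metis partial_y_def pderiv_eq_0_iff degree_eq_zeroE)
  then have "pderiv p = 0"
    using assms(1) by (simp add: partial_x_pCons)
  then show ?thesis
    using that p by (metis pderiv_eq_0_iff degree_eq_zeroE const2_def)
qed

text \<open>
  With \<open>a = D x\<close>, \<open>b = D y\<close>: multiplying \<open>a s\<^sub>x + b s\<^sub>y = 1\<close> by \<open>a\<^sub>y\<close> and replacing \<open>b a\<^sub>y\<close> by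
  \<open>- a a\<^sub>x\<close> exhibits \<open>a\<^sub>y\<close> as a multiple of \<open>a\<close>; symmetrically \<open>b\<^sub>x\<close> is a multiple of \<open>b\<close>.
\<close>

lemma nice_derivation_with_slice_constant:
  fixes D :: "'k::field_char_0 poly poly \<Rightarrow> 'k poly poly"
  assumes D: "k_derivation D" and nice: "D (D varX) = 0" "D (D varY) = 0" and s: "D s = 1"
  obtains \<alpha> \<beta> where "D varX = const2 \<alpha>" "D varY = const2 \<beta>"
proof -
  define a b where "a = D varX" and "b = D varY"
  note chain = k_derivation_chain_rule[OF D, folded a_def b_def]
  have a0: "a * partial_x a + b * partial_y a = 0"
    using nice(1) chain[of a] by (simp add: a_def)
  have b0: "a * partial_x b + b * partial_y b = 0"
    using nice(2) chain[of b] by (simp add: b_def)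
  have s1: "a * partial_x s + b * partial_y s = 1"
    using s chain[of s] by simp
  have "partial_y a = a * (partial_x s * partial_y a - partial_y s * partial_x a)"
    using a0 s1 by algebra
  then have ay: "partial_y a = 0"
    using dvd_partial_y_imp_zero by (metis dvdI)
  have "partial_x b = b * (partial_y s * partial_x b - partial_x s * partial_y b)"
    using b0 s1 by algebra
  then have bx: "partial_x b = 0"
    using dvd_partial_x_imp_zero by (metis dvdI)
  have "partial_x a = 0"
    using a0 ay by (auto simp: partial_x_def)
  moreover have "partial_y b = 0"
    using b0 bx by (auto simp: partial_y_def)
  ultimately show ?thesis
    using that constant_of_partials_zero ay bx unfolding a_def b_def by metis
qed

text \<open>
  The images \<open>\<beta> x - \<alpha> y\<close> and \<open>m x + n y\<close> of the variables are chosen so that \<open>D\<close> kills the first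
  and sends the second to \<open>1\<close>; the normalization \<open>m \<alpha> + n \<beta> = 1\<close> is at the same time the
  determinant of the linear map.
\<close>

lemma constant_derivation_linear_conjugation:
  fixes D :: "'k::field poly poly \<Rightarrow> 'k poly poly"
  assumes D: "k_derivation D" and a: "D varX = const2 \<alpha>" and b: "D varY = const2 \<beta>"
    and nz: "\<alpha> \<noteq> 0 \<or> \<beta> \<noteq> 0"
  obtains \<psi> where "k_automorphism \<psi>" "\<And>f. \<psi> (partial_y f) = D (\<psi> f)"
proof -
  obtain m n where "m * \<alpha> + n * \<beta> = 1"
  proof (cases "\<alpha> = 0")
    case True
    then show ?thesis using nz that[of 0 "1 / \<beta>"] by simp
  next
    case False
    then show ?thesis using that[of "1 / \<alpha>" 0] by simp
  qed
  then have "const2 (m * \<alpha> + n * \<beta>) = 1"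
    by simp
  then have det: "const2 m * const2 \<alpha> + const2 n * const2 \<beta> = 1"
    by simp
  define \<psi> where
    "\<psi> = subst2 (const2 \<beta> * varX - const2 \<alpha> * varY) (const2 m * varX + const2 n * varY)"
  define \<phi> where
    "\<phi> = subst2 (const2 n * varX + const2 \<alpha> * varY) (const2 \<beta> * varY - const2 m * varX)"
  have endo: "k_endomorphism \<psi>" "k_endomorphism \<phi>"
    by (simp_all add: \<psi>_def \<phi>_def)
  have vars: "\<psi> varX = const2 \<beta> * varX - const2 \<alpha> * varY"
    "\<psi> varY = const2 m * varX + const2 n * varY"
    "\<phi> varX = const2 n * varX + const2 \<alpha> * varY"
    "\<phi> varY = const2 \<beta> * varY - const2 m * varX"
    by (simp_all add: \<psi>_def \<phi>_def)
  have "\<phi> (\<psi> varX) = varX" "\<phi> (\<psi> varY) = varY" "\<psi> (\<phi> varX) = varX" "\<psi> (\<phi> varY) = varY"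
    unfolding vars k_endomorphismD[OF endo(1)] k_endomorphismD[OF endo(2)]
    using det by algebra+
  then have "k_automorphism \<psi>"
    using k_automorphism_of_inverse_on_variables[OF endo] by blast
  moreover have "\<psi> (partial_y f) = D (\<psi> f)" for f
  proof (rule k_derivation_intertwine[OF partial_y_derivation D endo(1)])
    show "\<psi> (partial_y varX) = D (\<psi> varX)"
      by (simp add: vars k_endomorphismD[OF endo(1)] k_derivationD[OF D] a b mult.commute)
    show "\<psi> (partial_y varY) = D (\<psi> varY)"
      using det
      by (simp add: vars k_endomorphismD[OF endo(1)] k_derivationD[OF D] a b)
  qed
  ultimately show ?thesis
    using that by blast
qed

lemma triangular_automorphism:
  fixes p :: "'k::field poly"
  obtains \<tau> where "k_automorphism \<tau>" "\<And>f. \<tau> (partial_y f) = partial_y (\<tau> f)"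
    "\<tau> varY = [:p, 1:]"
proof -
  define \<tau> where "\<tau> = subst2 varX (varY + [:p:])"
  define \<sigma> where "\<sigma> = subst2 varX (varY - [:p:])"
  have endo: "k_endomorphism \<tau>" "k_endomorphism \<sigma>"
    by (simp_all add: \<tau>_def \<sigma>_def)
  have vars: "\<tau> varX = varX" "\<tau> varY = varY + [:p:]" "\<sigma> varX = varX" "\<sigma> varY = varY - [:p:]"
    "\<tau> [:p:] = [:p:]" "\<sigma> [:p:] = [:p:]"
    by (simp_all add: \<tau>_def \<sigma>_def)
  have "k_automorphism \<tau>"
    using endo
    by (rule k_automorphism_of_inverse_on_variables)
      (simp_all only: vars k_endomorphismD[OF endo(1)] k_endomorphismD[OF endo(2)]
        add_diff_cancel_right' diff_add_cancel)
  moreover have "\<tau> (partial_y f) = partial_y (\<tau> f)" for f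
    by (rule k_derivation_intertwine[OF partial_y_derivation partial_y_derivation endo(1)])
      (simp_all add: vars k_endomorphismD[OF endo(1)] k_derivationD[OF partial_y_derivation],
        simp add: partial_y_def)
  moreover have "\<tau> varY = [:p, 1:]"
    unfolding vars by (simp add: varY_def)
  ultimately show ?thesis
    using that by blast
qed

lemma partial_y_slice:
  fixes f :: "'k::field_char_0 poly poly"
  assumes "partial_y f = 1"
  obtains p where "f = [:p, 1:]"
proof -
  have "partial_y (f - varY) = 0"
    using assms by (simp add: k_derivationD[OF partial_y_derivation])
  then obtain p where "f - varY = [:p:]"
    by (metis partial_y_def pderiv_eq_0_iff degree_eq_zeroE)
  then have "f = [:p:] + varY"
    by (simp add: algebra_simps)
  then show ?thesis
    using that by (simp add: varY_def)
qed

lemma straightening_automorphism: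
  fixes D :: "'k::field_char_0 poly poly \<Rightarrow> 'k poly poly"
  assumes D: "k_derivation D" and nice: "D (D varX) = 0" "D (D varY) = 0" and s: "D s = 1"
  obtains \<Phi> where "k_automorphism \<Phi>" "\<And>f. \<Phi> (D f) = partial_y (\<Phi> f)" "\<Phi> s = varY"
proof -
  obtain \<alpha> \<beta> where ab: "D varX = const2 \<alpha>" "D varY = const2 \<beta>"
    using nice_derivation_with_slice_constant[OF assms] .
  have "\<alpha> \<noteq> 0 \<or> \<beta> \<noteq> 0"
    using s k_derivation_chain_rule[OF D, of s] ab by auto
  then obtain \<psi> where \<psi>: "k_automorphism \<psi>" "\<And>f. \<psi> (partial_y f) = D (\<psi> f)"
    using constant_derivation_linear_conjugation[OF D ab] by blast
  have bij: "bij \<psi>" and endo: "k_endomorphism \<psi>"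
    using \<psi>(1) by (simp_all add: k_automorphism_iff)
  then have "\<psi> (partial_y (inv \<psi> s)) = \<psi> 1"
    by (simp add: \<psi>(2) s bij_is_surj surj_f_inv_f k_endomorphismD)
  then have "partial_y (inv \<psi> s) = 1"
    using bij by (simp add: bij_is_inj inj_eq)
  then obtain p where p: "inv \<psi> s = [:p, 1:]"
    by (rule partial_y_slice)
  obtain \<tau> where \<tau>: "k_automorphism \<tau>" "\<And>f. \<tau> (partial_y f) = partial_y (\<tau> f)"
    "\<tau> varY = [:p, 1:]"
    using triangular_automorphism[of p] by blast
  define \<Psi> where "\<Psi> = \<psi> \<circ> \<tau>"
  have \<Psi>: "k_automorphism \<Psi>"
    unfolding \<Psi>_def using \<psi>(1) \<tau>(1) by (rule k_automorphism_comp)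
  then have bij\<Psi>: "bij \<Psi>"
    by (simp add: k_automorphism_iff)
  have "\<Psi> (partial_y f) = D (\<Psi> f)" for f
    by (simp add: \<Psi>_def \<tau>(2) \<psi>(2))
  then have "inv \<Psi> (D f) = partial_y (inv \<Psi> f)" for f
    using bij\<Psi> by (metis bij_inv_eq_iff)
  moreover have "\<Psi> varY = s"
    using bij by (simp add: \<Psi>_def \<tau>(3) flip: p) (simp add: bij_is_surj surj_f_inv_f)
  then have "inv \<Psi> s = varY"
    using bij\<Psi> by (metis bij_inv_eq_iff)
  ultimately show ?thesis
    using that k_automorphism_inv[OF \<Psi>] by blast
qed

section \<open>The action in straightened coordinates\<close>

definition scale_y :: "'k::field \<Rightarrow> 'k poly poly \<Rightarrow> 'k poly poly" where
  "scale_y u f = pcompose f [:0, [:u:]:]"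

lemma coeff_scale_y: "coeff (scale_y u f) i = smult (u ^ i) (coeff f i)"
proof -
  have "[:u:] ^ i = [:u ^ i:]"
    by (induction i) (simp_all add: one_pCons)
  then show ?thesis
    by (simp add: scale_y_def coeff_pcompose_linear)
qed

lemma scale_y_endomorphism: "k_endomorphism (scale_y u)"
  by (simp add: k_endomorphism_def scale_y_def pcompose_add pcompose_mult const2_def)

lemma scale_y_inner: "scale_y u [:p:] = [:p:]"
  by (simp add: scale_y_def)

lemma scale_y_varY: "scale_y u varY = const2 u * varY"
  by (simp add: scale_y_def varY_def const2_def pcompose_pCons)

lemma scale_y_one: "scale_y 1 f = f"
  by (rule poly_eqI) (simp add: coeff_scale_y)

lemma scale_y_mult: "scale_y (u * v) f = scale_y u (scale_y v f)"
  by (rule poly_eqI) (simp add: coeff_scale_y power_mult_distrib)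

lemma scale_y_automorphism:
  assumes "u \<noteq> 0"
  shows "k_automorphism (scale_y u)"
proof -
  have "scale_y u (scale_y (inverse u) f) = f" "scale_y (inverse u) (scale_y u f) = f" for f
    using assms by (simp_all flip: scale_y_mult add: scale_y_one)
  then show ?thesis
    by (metis k_automorphism_iff scale_y_endomorphism bijI')
qed

lemma scale_y_expansion:
  "scale_y u f = (\<Sum>i\<le>degree f. const2 (u ^ i) * monom (coeff f i) i)"
proof (rule poly_eqI)
  fix j
  show "coeff (scale_y u f) j = coeff (\<Sum>i\<le>degree f. const2 (u ^ i) * monom (coeff f i) i) j"
  proof (cases "j \<le> degree f")
    case True
    then show ?thesis
      by (simp add: coeff_scale_y coeff_sum const2_def smult_monom if_distrib cong: if_cong)
  next
    case False
    then show ?thesis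
      by (simp add: coeff_scale_y coeff_sum const2_def smult_monom coeff_eq_0)
  qed
qed

text \<open>
  Euler's identity in the variable \<open>y\<close>: compared with \<open>scale_y_expansion\<close>, it says that \<open>y \<partial>/\<partial>y\<close> is
  the derivative of the scaling \<open>y \<mapsto> u y\<close> at \<open>u = 1\<close>.
\<close>

lemma euler_y_expansion:
  "varY * partial_y f = (\<Sum>i\<le>degree f. of_nat i * monom (coeff f i) i)"
proof (rule poly_eqI)
  fix j
  have l: "coeff (varY * partial_y f) j = of_nat j * coeff f j"
    by (cases j) (simp_all add: varY_def partial_y_def coeff_pderiv)
  have r: "coeff (of_nat i * monom (coeff f i) i) j = (if i = j then of_nat j * coeff f j else 0)"
    for i by (simp add: of_nat_poly)
  show "coeff (varY * partial_y f) j = coeff (\<Sum>i\<le>degree f. of_nat i * monom (coeff f i) i) j"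
    by (cases "j \<le> degree f") (simp_all add: l r coeff_sum coeff_eq_0)
qed

lemma k_endomorphism_poly:
  assumes "k_endomorphism h" "\<And>i. h (coeff P i) = coeff P i"
  shows "h (poly P s) = poly P (h s)"
  using assms(2)
proof (induction P)
  case 0
  show ?case by (simp add: k_endomorphismD[OF assms(1)])
next
  case (pCons a P)
  have "h a = a" "\<And>i. h (coeff P i) = coeff P i"
    using pCons.prems[of 0] pCons.prems[of "Suc i" for i] by simp_all
  then show ?case
    using pCons.IH by (simp add: k_endomorphismD[OF assms(1)])
qed

lemma k_endomorphism_poly_in_y:
  assumes "k_endomorphism h"
  shows "h f = poly (map_poly (\<lambda>p. h [:p:]) f) (h varY)"
proof (induction f)
  case 0
  show ?case by (simp add: k_endomorphismD[OF assms])
next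
  case (pCons p f)
  have "pCons p f = [:p:] + varY * f"
    by (simp add: varY_def)
  then have "h (pCons p f) = h [:p:] + h varY * h f"
    by (simp add: k_endomorphismD[OF assms])
  then show ?case
    using pCons.IH by (simp add: map_poly_pCons k_endomorphismD[OF assms])
qed

text \<open>
  The conjugate of \<open>y \<mapsto> t\<^sup>N y\<close> is a ring homomorphism that fixes \<open>ker D\<close> and sends \<open>s\<close> to \<open>t\<^sup>N s\<close>,
  so it sends \<open>P(s)\<close> to \<open>P(t\<^sup>N s)\<close> for every \<open>P\<close> over \<open>ker D\<close>. The value is thus the same for all
  expansions of \<open>b\<close>, and an expansion exists, namely the one of \<open>\<Phi> b\<close> in powers of \<open>y\<close> carried
  back. Hence the description in the definition of the action denotes this conjugate.
\<close>

lemma slice_action_straightened: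
  fixes D :: "'k::field_char_0 poly poly \<Rightarrow> 'k poly poly"
  assumes \<Phi>: "k_automorphism \<Phi>" and \<Phi>D: "\<And>f. \<Phi> (D f) = partial_y (\<Phi> f)"
    and \<Phi>s: "\<Phi> s = varY"
  shows "slice_action D s N t b = inv \<Phi> (scale_y (t powi N) (\<Phi> b))"
proof -
  define \<Psi> where "\<Psi> = inv \<Phi>"
  have bij: "bij \<Phi>" and \<Phi>_endo: "k_endomorphism \<Phi>"
    using \<Phi> by (simp_all add: k_automorphism_iff)
  have \<Psi>_endo: "k_endomorphism \<Psi>"
    using k_automorphism_inv[OF \<Phi>] by (simp add: \<Psi>_def k_automorphism_iff)
  have inv [simp]: "\<Phi> (\<Psi> f) = f" "\<Psi> (\<Phi> f) = f" for f
    using bij by (simp_all add: \<Psi>_def bij_is_surj surj_f_inv_f bij_is_inj)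
  have \<Psi>Y: "\<Psi> varY = s"
    using inv(2)[of s] \<Phi>s by simp
  have ker: "D f = 0 \<longleftrightarrow> (\<exists>p. \<Phi> f = [:p:])" for f
  proof -
    have "D f = 0 \<longleftrightarrow> \<Phi> (D f) = \<Phi> 0"
      using bij by (metis bij_is_inj inj_eq)
    also have "\<dots> \<longleftrightarrow> degree (\<Phi> f) = 0"
      by (simp add: \<Phi>D k_endomorphismD[OF \<Phi>_endo] partial_y_def pderiv_eq_0_iff)
    also have "\<dots> \<longleftrightarrow> (\<exists>p. \<Phi> f = [:p:])"
      by (metis degree_eq_zeroE degree_pCons_0)
    finally show ?thesis .
  qed
  define u where "u = t powi N"
  define h where "h = \<Psi> \<circ> (scale_y u \<circ> \<Phi>)"
  have h_endo: "k_endomorphism h"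
    unfolding h_def
    by (intro k_endomorphism_comp \<Psi>_endo \<Phi>_endo scale_y_endomorphism)
  have hs: "h s = const2 u * s"
    by (simp add: h_def \<Phi>s scale_y_varY k_endomorphismD[OF \<Psi>_endo] \<Psi>Y)
  have h_ker: "h f = f" if "D f = 0" for f
  proof -
    obtain p where "\<Phi> f = [:p:]"
      using \<open>D f = 0\<close> ker by blast
    then have "h f = \<Psi> (\<Phi> f)"
      by (simp add: h_def scale_y_inner)
    then show ?thesis by simp
  qed
  have unique: "poly P (const2 u * s) = h (poly P s)" if "\<And>i. D (coeff P i) = 0" for P
    using k_endomorphism_poly[OF h_endo, of P s] h_ker that hs by simp
  define Q where "Q = map_poly (\<lambda>p. \<Psi> [:p:]) (\<Phi> b)"
  have Q_ker: "D (coeff Q i) = 0" for i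
    unfolding ker by (simp add: Q_def coeff_map_poly k_endomorphismD[OF \<Psi>_endo])
  have Q_b: "b = poly Q s"
    using k_endomorphism_poly_in_y[OF \<Psi>_endo, of "\<Phi> b"] \<Psi>Y by (simp add: Q_def)
  have "slice_action D s N t b = h b"
    unfolding slice_action_def u_def[symmetric]
    using Q_ker Q_b unique by (intro the_equality) metis+
  then show ?thesis
    by (simp add: h_def u_def \<Psi>_def)
qed

text \<open>
  Weight components exist only for the multiples \<open>N i\<close> of \<open>N\<close>; as \<open>N \<noteq> 0\<close>, distinct powers
  of \<open>y\<close> have distinct weights, so that the component of weight \<open>N i\<close> is exactly the \<open>y\<^sup>i\<close>-term.
\<close>

lemma scaling_action_has_derivation:
  fixes D :: "'k::field_char_0 poly poly \<Rightarrow> 'k poly poly"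
  assumes \<Phi>: "k_automorphism \<Phi>" and \<Phi>D: "\<And>f. \<Phi> (D f) = partial_y (\<Phi> f)"
    and \<Phi>s: "\<Phi> s = varY" and N: "N \<noteq> 0"
  shows "Gm_action_of_derivation (\<lambda>t b. inv \<Phi> (scale_y (t powi N) (\<Phi> b)))
           (\<lambda>b. of_int N * s * D b)"
proof -
  define \<Psi> where "\<Psi> = inv \<Phi>"
  have bij: "bij \<Phi>" and \<Phi>_endo: "k_endomorphism \<Phi>"
    using \<Phi> by (simp_all add: k_automorphism_iff)
  have \<Psi>: "k_automorphism \<Psi>"
    using k_automorphism_inv[OF \<Phi>] by (simp add: \<Psi>_def)
  then have \<Psi>_endo: "k_endomorphism \<Psi>"
    by (simp add: k_automorphism_iff)
  have inv [simp]: "\<Phi> (\<Psi> f) = f" "\<Psi> (\<Phi> f) = f" for f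
    using bij by (simp_all add: \<Psi>_def bij_is_surj surj_f_inv_f bij_is_inj)
  have "\<exists>c :: int \<Rightarrow> 'k poly poly. finite {n. c n \<noteq> 0} \<and>
      (\<forall>t. t \<noteq> 0 \<longrightarrow> \<Psi> (scale_y (t powi N) (\<Phi> b)) =
        (\<Sum>n | c n \<noteq> 0. const2 (t powi n) * c n)) \<and>
      of_int N * s * D b = (\<Sum>n | c n \<noteq> 0. of_int n * c n)" for b
  proof -
    define e where "e i = \<Psi> (monom (coeff (\<Phi> b) i) i)" for i
    define w where "w i = N * int i" for i
    define c where "c n = (if n \<in> range w then e (inv_into UNIV w n) else 0)" for n
    let ?I = "{..degree (\<Phi> b)}"
    have inj: "inj w"
      using N by (simp add: w_def inj_def)
    then have cw: "c (w i) = e i" for i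
      by (simp add: c_def)
    have e0: "e i = 0" if "i \<notin> ?I" for i
      using that by (simp add: e_def coeff_eq_0 k_endomorphismD[OF \<Psi>_endo])
    have supp: "{n. c n \<noteq> 0} \<subseteq> w ` ?I"
    proof
      fix n assume "n \<in> {n. c n \<noteq> 0}"
      then have "c n \<noteq> 0"
        by (rule CollectD)
      then have "n \<in> range w"
        unfolding c_def by argo
      then obtain i where i: "n = w i"
        by (rule rangeE)
      from \<open>c n \<noteq> 0\<close> have "e i \<noteq> 0"
        unfolding i cw .
      then have "i \<in> ?I"
        using e0[of i] by blast
      then show "n \<in> w ` ?I"
        unfolding i by (rule imageI)
    qed
    then have fin: "finite {n. c n \<noteq> 0}"
      by (rule finite_subset) simp
    have weight_sum: "(\<Sum>n | c n \<noteq> 0. F n * c n) = (\<Sum>i\<in>?I. F (w i) * e i)" for F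
    proof -
      have "(\<Sum>n | c n \<noteq> 0. F n * c n) = (\<Sum>n\<in>w ` ?I. F n * c n)"
        using supp by (intro sum.mono_neutral_left) auto
      also have "\<dots> = (\<Sum>i\<in>?I. F (w i) * e i)"
        by (simp add: sum.reindex inj_on_subset[OF inj] cw)
      finally show ?thesis .
    qed
    have "\<Psi> (scale_y (t powi N) (\<Phi> b)) = (\<Sum>n | c n \<noteq> 0. const2 (t powi n) * c n)" for t
      by (simp add: weight_sum scale_y_expansion k_endomorphism_sum[OF \<Psi>_endo]
          k_endomorphismD[OF \<Psi>_endo] e_def w_def power_int_mult)
    moreover have "of_int N * s * D b = (\<Sum>n | c n \<noteq> 0. of_int n * c n)"
    proof -
      have "of_int N * s * D b = \<Psi> (\<Phi> (of_int N * s * D b))"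
        by simp
      also have "\<dots> = \<Psi> (of_int N * (varY * partial_y (\<Phi> b)))"
        by (simp only: k_endomorphismD[OF \<Phi>_endo] \<Phi>D \<Phi>s mult.assoc)
      also have "\<dots> = (\<Sum>i\<in>?I. of_int (w i) * e i)"
      proof -
        have "\<Psi> (of_nat i) = of_nat i" for i
          using k_endomorphismD(8)[OF \<Psi>_endo, of "int i"] by simp
        then show ?thesis
          by (simp add: euler_y_expansion k_endomorphism_sum[OF \<Psi>_endo]
              k_endomorphismD[OF \<Psi>_endo] e_def w_def sum_distrib_left mult.assoc)
      qed
      finally show ?thesis
        by (simp only: weight_sum)
    qed
    ultimately show ?thesis
      using fin by blast
  qed
  moreover have "\<forall>t. t \<noteq> 0 \<longrightarrow> k_automorphism (\<lambda>b. \<Psi> (scale_y (t powi N) (\<Phi> b)))"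
  proof (intro allI impI)
    fix t :: 'k assume "t \<noteq> 0"
    then have "k_automorphism (\<Psi> \<circ> (scale_y (t powi N) \<circ> \<Phi>))"
      by (intro k_automorphism_comp \<Psi> \<Phi> scale_y_automorphism) simp
    then show "k_automorphism (\<lambda>b. \<Psi> (scale_y (t powi N) (\<Phi> b)))"
      by (simp add: comp_def)
  qed
  moreover have "\<forall>b. \<Psi> (scale_y (1 powi N) (\<Phi> b)) = b"
    by (simp add: scale_y_one)
  moreover have "\<forall>t u b. t \<noteq> 0 \<longrightarrow> u \<noteq> 0 \<longrightarrow> \<Psi> (scale_y ((t * u) powi N) (\<Phi> b)) =
      \<Psi> (scale_y (t powi N) (\<Phi> (\<Psi> (scale_y (u powi N) (\<Phi> b)))))"
    by (simp add: scale_y_mult power_int_mult_distrib)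
  ultimately show ?thesis
    unfolding Gm_action_of_derivation_def \<Psi>_def[symmetric] by (intro conjI) (assumption | rule allI)+
qed

theorem corollary6p4:
  fixes D :: "'k::{alg_closed_field, field_char_0} poly poly \<Rightarrow> 'k poly poly"
    and s :: "'k poly poly"
    and N :: int
  assumes "nice_LND D"
    and "is_slice D s"
    and "N \<noteq> 0"
  shows "linearizable_action (slice_action D s N) (\<lambda>b. of_int N * s * D b) \<and>
         (\<exists>\<phi>. k_automorphism \<phi> \<and> conj_by \<phi> D = partial_y)"
proof -
  have "k_derivation D" "D (D varX) = 0" "D (D varY) = 0" "D s = 1"
    using assms by (simp_all add: nice_LND_def is_slice_def numeral_2_eq_2)
  then obtain \<Phi> where \<Phi>: "k_automorphism \<Phi>" and \<Phi>D: "\<And>f. \<Phi> (D f) = partial_y (\<Phi> f)"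
    and \<Phi>s: "\<Phi> s = varY"
    using straightening_automorphism by blast
  have bij: "bij \<Phi>" and endo: "k_endomorphism \<Phi>"
    using \<Phi> by (simp_all add: k_automorphism_iff)
  have inv: "\<Phi> (inv \<Phi> f) = f" for f
    using bij by (simp add: bij_is_surj surj_f_inv_f)
  have "slice_action D s N = (\<lambda>t b. inv \<Phi> (scale_y (t powi N) (\<Phi> b)))"
    using slice_action_straightened[OF \<Phi> \<Phi>D \<Phi>s] by (intro ext)
  then have "Gm_action_of_derivation (slice_action D s N) (\<lambda>b. of_int N * s * D b)"
    using scaling_action_has_derivation[OF \<Phi> \<Phi>D \<Phi>s \<open>N \<noteq> 0\<close>] by simp
  moreover have "conj_by \<Phi> (\<lambda>b. of_int N * s * D b) = diagonal_derivation 0 (of_int N)"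
    by (rule ext)
      (simp add: conj_by_def diagonal_derivation_def k_endomorphismD[OF endo] \<Phi>D \<Phi>s inv)
  moreover have "conj_by \<Phi> D = partial_y"
    by (rule ext) (simp add: conj_by_def \<Phi>D inv)
  ultimately show ?thesis
    unfolding linearizable_action_def using \<Phi> by blast
qed

end
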